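(* Let $(X,r)$ be a set theoretic involutive non-degenerate square free solution of the Yang-Baxter equation on a finite set $X=\{x_1,\dots,x_n\}$, $n\ge 1$, such that each of the generators $\sigma_1,\dots,\sigma_n$ of its IYB group $G_r$ is a cyclic permutation. Then $(X,r)$ is strongly retractable. Moreover, if $|X|>1$ then $(X,r)$ is a generalized twisted union.
   Context: A set theoretic involutive non-degenerate solution of the Yang-Baxter equation on a finite set $X=\{x_1,\dots,x_n\}$ is a pair $(X,r)$ with $r\colon X^2\to X^2$ such that: (1) $r^2=\mathrm{id}_{X^2}$; (2) for all $i,j\in\{1,\dots,n\}$ there exist unique $k,l\in\{1,\dots,n\}$ with $r(x_i,x_k)=(x_j,x_l)$; (3) $r_{12}\circ r_{23}\circ r_{12}=r_{23}\circ r_{12}\circ r_{23}$, where $r_{ij}\colon X^3\to X^3$ acts as $r$ on the components $(i,j)$ and as the identity on the remaining component. It is square free if $r(x_i,x_i)=(x_i,x_i)$ for all $i$. The maps $\sigma_i,\gamma_i$ on $\{1,\dots,n\}$ defined by $r(x_i,x_k)=(x_{\sigma_i(k)},x_{\gamma_k(i)})$ are bijective. The group $G_r=\langle\sigma_1,\dots,\sigma_n\rangle\subseteq\operatorname{Sym}_n$ is the involutive Yang-Baxter (IYB) group of $(X,r)$; it acts on $X$ by $\sigma(x_i)=x_{\sigma(i)}$. For $x=x_i$ we also write $\sigma_x=\sigma_i$, $\gamma_x=\gamma_i$, viewed as permutations of $X$ via $x_j\mapsto x_{\sigma_i(j)}$, $x_j\mapsto x_{\gamma_i(j)}$. A cyclic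 permutation is a permutation that is a single cycle (fixing all points outside the cycle); the identity is allowed (cycle of length $1$). The solution is trivial if $r(x_i,x_j)=(x_j,x_i)$ for all $i,j$ (equivalently, every $\sigma_i$ is the identity). For a square free solution, the relation $\rho$ on $X$ is: $(x_i,x_j)\in\rho$ if and only if $x_i,x_j$ lie in the same $G_r$-orbit on $X$ and $\sigma_i=\sigma_j$. It is an equivalence relation compatible with $r$, and $\bar r(\overline{x_i},\overline{x_j})=(\overline{x_k},\overline{x_l})$ if $r(x_i,x_j)=(x_k,x_l)$ defines a set theoretic involutive non-degenerate square free solution $Ret_\rho(X,r)=(X/\rho,\bar r)$. The solution $(X,r)$ is strongly retractable if there exists $m\ge 1$ such that applying the operator $Ret_\rho$ $m$ times (at each step using the relation $\rho$ of the current solution) yields a trivial solution. $(X,r)$ is a generalized twisted union (of solutions $(Y,r_Y)$ and $(Z,r_Z)$, the restrictions of $r$ to $Y^2$ and $Z^2$) if $X$ is a disjoint union of two non-empty $G_r$-invariant subsets $Y,Z$ such that for all $z,z'\in Z$ and $y,y'\in Y$: $$\sigma_{\gamma_{y}(z)}|_{Y}=\sigma_{\gamma_{y'}(z)}|_{Y}\quad\text{and}\quad \gamma_{\sigma_{z}(y)}|_{Z}=\gamma_{\sigma_{z'}(y)}|_{Z}.$$ (For square free solutions these two conditions are equivalent to $\sigma_{\sigma_y(z)}|_Y=\sigma_z|_Y$ and $\sigma_{\sigma_z(y)}|_Z=\sigma_y|_Z$ for all $y\in Y$, $z\in Z$.) *)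

theory Defs
  imports
    "HOL-Algebra.Bij"
    "HOL-Algebra.Generated_Groups"
    "HOL-Combinatorics.Orbits"
    "HOL-Library.FSet"
begin

text \<open>
  A solution is given by a carrier set \<open>X\<close> and a map \<open>r\<close> on pairs; the values of \<open>r\<close>
  outside \<open>X \<times> X\<close> are irrelevant.
\<close>

definition r12 :: "('a \<times> 'a \<Rightarrow> 'a \<times> 'a) \<Rightarrow> 'a \<times> 'a \<times> 'a \<Rightarrow> 'a \<times> 'a \<times> 'a" where
  "r12 r = (\<lambda>(x, y, z). (fst (r (x, y)), snd (r (x, y)), z))"

definition r23 :: "('a \<times> 'a \<Rightarrow> 'a \<times> 'a) \<Rightarrow> 'a \<times> 'a \<times> 'a \<Rightarrow> 'a \<times> 'a \<times> 'a" where
  "r23 r = (\<lambda>(x, y, z). (x, r (y, z)))"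

definition yb_solution :: "'a set \<Rightarrow> ('a \<times> 'a \<Rightarrow> 'a \<times> 'a) \<Rightarrow> bool" where
  "yb_solution X r \<longleftrightarrow>
     finite X \<and>
     (\<forall>p \<in> X \<times> X. r p \<in> X \<times> X) \<and>
     (\<forall>p \<in> X \<times> X. r (r p) = p) \<and>
     (\<forall>x \<in> X. \<forall>y \<in> X. \<exists>!p. p \<in> X \<times> X \<and> r (x, fst p) = (y, snd p)) \<and>
     (\<forall>t \<in> X \<times> X \<times> X. r12 r (r23 r (r12 r t)) = r23 r (r12 r (r23 r t)))"

definition square_free :: "'a set \<Rightarrow> ('a \<times> 'a \<Rightarrow> 'a \<times> 'a) \<Rightarrow> bool" where
  "square_free X r \<longleftrightarrow> (\<forall>x \<in> X. r (x, x) = (x, x))"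

definition trivial_solution :: "'a set \<Rightarrow> ('a \<times> 'a \<Rightarrow> 'a \<times> 'a) \<Rightarrow> bool" where
  "trivial_solution X r \<longleftrightarrow> (\<forall>x \<in> X. \<forall>y \<in> X. r (x, y) = (y, x))"

text \<open>\<open>r (x, y) = (sigma r x y, gamma r y x)\<close>\<close>

definition sigma :: "('a \<times> 'a \<Rightarrow> 'a \<times> 'a) \<Rightarrow> 'a \<Rightarrow> 'a \<Rightarrow> 'a" where
  "sigma r x y = fst (r (x, y))"

definition gamma :: "('a \<times> 'a \<Rightarrow> 'a \<times> 'a) \<Rightarrow> 'a \<Rightarrow> 'a \<Rightarrow> 'a" where
  "gamma r y x = snd (r (x, y))"

definition iyb_group :: "'a set \<Rightarrow> ('a \<times> 'a \<Rightarrow> 'a \<times> 'a) \<Rightarrow> ('a \<Rightarrow> 'a) set" where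
  "iyb_group X r = generate (BijGroup X) ((\<lambda>x. restrict (sigma r x) X) ` X)"

text \<open>
  \<open>cyclic_on f S\<close> also holds for a singleton \<open>S = {s}\<close> with \<open>f s = s\<close>, so the identity of
  a non-empty set is cyclic.
\<close>

definition cyclic_permutation :: "'a set \<Rightarrow> ('a \<Rightarrow> 'a) \<Rightarrow> bool" where
  "cyclic_permutation X f \<longleftrightarrow>
     bij_betw f X X \<and> (\<exists>S \<subseteq> X. cyclic_on f S \<and> (\<forall>x \<in> X - S. f x = x))"

definition rho :: "'a set \<Rightarrow> ('a \<times> 'a \<Rightarrow> 'a \<times> 'a) \<Rightarrow> ('a \<times> 'a) set" where
  "rho X r = {(x, y). x \<in> X \<and> y \<in> X \<and> (\<exists>g \<in> iyb_group X r. g x = y) \<and>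
                     (\<forall>z \<in> X. sigma r x z = sigma r y z)}"

text \<open>
  The map induced by \<open>r\<close> on \<open>X // rho X r\<close>. As \<open>rho X r\<close> is compatible with \<open>r\<close> for a
  square free solution, the set under \<open>the_elem\<close> is then a singleton.
\<close>

definition rbar ::
  "'a set \<Rightarrow> ('a \<times> 'a \<Rightarrow> 'a \<times> 'a) \<Rightarrow> 'a set \<times> 'a set \<Rightarrow> 'a set \<times> 'a set" where
  "rbar X r = (\<lambda>(C, D).
     the_elem ((\<lambda>p. (rho X r `` {fst (r p)}, rho X r `` {snd (r p)})) ` (C \<times> D)))"

text \<open>
  Passing to the quotient changes the type of the elements from \<open>'a\<close> to \<open>'a set\<close>. To
  iterate it, work in a type that contains the elements of \<open>'a\<close> and all finite sets of its
  own elements; a class \<open>C\<close> is then recorded as the element \<open>Cls (Abs_fset C)\<close>.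
\<close>

datatype 'a elt = Pt 'a | Cls "'a elt fset"

definition transport ::
  "('a \<Rightarrow> 'b) \<Rightarrow> 'a set \<times> ('a \<times> 'a \<Rightarrow> 'a \<times> 'a) \<Rightarrow> 'b set \<times> ('b \<times> 'b \<Rightarrow> 'b \<times> 'b)" where
  "transport f = (\<lambda>(X, r).
     (f ` X, map_prod f f \<circ> r \<circ> map_prod (inv_into X f) (inv_into X f)))"

definition Ret ::
  "'a elt set \<times> ('a elt \<times> 'a elt \<Rightarrow> 'a elt \<times> 'a elt) \<Rightarrow>
   'a elt set \<times> ('a elt \<times> 'a elt \<Rightarrow> 'a elt \<times> 'a elt)" where
  "Ret = (\<lambda>(X, r). transport (\<lambda>C. Cls (Abs_fset C)) (X // rho X r, rbar X r))"

definition strongly_retractable :: "'a set \<Rightarrow> ('a \<times> 'a \<Rightarrow> 'a \<times> 'a) \<Rightarrow> bool" where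
  "strongly_retractable X r \<longleftrightarrow>
     (\<exists>m \<ge> 1. case (Ret ^^ m) (transport Pt (X, r)) of (Y, s) \<Rightarrow> trivial_solution Y s)"

definition invariant_subset :: "'a set \<Rightarrow> ('a \<times> 'a \<Rightarrow> 'a \<times> 'a) \<Rightarrow> 'a set \<Rightarrow> bool" where
  "invariant_subset X r Y \<longleftrightarrow> Y \<subseteq> X \<and> (\<forall>g \<in> iyb_group X r. \<forall>y \<in> Y. g y \<in> Y)"

definition generalized_twisted_union :: "'a set \<Rightarrow> ('a \<times> 'a \<Rightarrow> 'a \<times> 'a) \<Rightarrow> bool" where
  "generalized_twisted_union X r \<longleftrightarrow>
     (\<exists>Y Z. X = Y \<union> Z \<and> Y \<inter> Z = {} \<and> Y \<noteq> {} \<and> Z \<noteq> {} \<and>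
        invariant_subset X r Y \<and> invariant_subset X r Z \<and>
        yb_solution Y r \<and> yb_solution Z r \<and>
        (\<forall>z \<in> Z. \<forall>z' \<in> Z. \<forall>y \<in> Y. \<forall>y' \<in> Y.
           (\<forall>w \<in> Y. sigma r (gamma r y z) w = sigma r (gamma r y' z) w) \<and>
           (\<forall>w \<in> Z. gamma r (sigma r z y) w = gamma r (sigma r z' y) w)))"

end

theory Submission
  imports Defs
begin

text \<open>
  Write \<open>x \<rightarrow> a\<close> if \<open>\<sigma>\<^sub>x\<close> moves \<open>a\<close>, and \<open>supp x\<close> for the set of all such \<open>a\<close>.
  In a square free solution \<open>\<gamma>\<^sub>y\<close> is the inverse of \<open>\<sigma>\<^sub>y\<close> (\<open>sigma_gamma\<close>), and the
  braid relation yields \<open>\<sigma>\<^bsub>\<sigma>\<^sub>y x\<^esub>(y) = \<sigma>\<^sub>x(y)\<close> (\<open>cyclic_condition\<close>) and, if \<open>\<sigma>\<^sub>a(x) = x\<close>,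
  \<open>\<sigma>\<^bsub>\<sigma>\<^sub>x a\<^esub> = \<sigma>\<^sub>x \<sigma>\<^sub>a \<sigma>\<^sub>x\<^sup>-\<^sup>1\<close> (\<open>sigma_conjugate\<close>).

  Retractability. If \<open>x \<rightarrow> a\<close> and \<open>a \<rightarrow> x\<close>, the cyclic condition makes
  \<open>\<sigma>\<^sub>a\<close> and \<open>\<sigma>\<^bsub>\<sigma>\<^sub>x a\<^esub>\<close> agree on a cycle of \<open>\<sigma>\<^sub>a\<close>; both being single cycles, they are equal
  (\<open>sigma_eq_of_mutual_move\<close>). Suppose now that no \<open>x \<rightarrow> a\<close> satisfies
  \<open>\<sigma>\<^bsub>\<sigma>\<^sub>x a\<^esub> = \<sigma>\<^sub>a\<close>. Then \<open>\<rightarrow>\<close> is antisymmetric, so \<open>x \<rightarrow> a\<close> always gives the conjugation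
  formula, and in particular \<open>supp x\<close> meets \<open>supp a\<close> (otherwise \<open>\<sigma>\<^sub>x\<close> and \<open>\<sigma>\<^sub>a\<close> commute). By
  conjugation with \<open>\<sigma>\<^sub>x\<close>, the numbers \<open>|supp a|\<close> and \<open>|supp x \<inter> supp a|\<close> and the set
  \<open>supp a - supp x\<close> are the same for all \<open>a \<in> supp x\<close>. Thus \<open>\<rightarrow>\<close> restricted to \<open>supp x\<close> is an
  oriented graph with constant out-degree, whence \<open>2 |supp x \<inter> supp a| < |supp x|\<close>. Choose
  \<open>x \<rightarrow> y\<close>, then \<open>a \<in> supp x \<inter> supp y\<close>, then \<open>b \<in> supp y \<inter> supp a\<close>. Here
  \<open>|supp y| = |supp a| = k\<close>, so fewer than \<open>k/2\<close> points of \<open>supp a\<close> lie in \<open>supp y\<close>. The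
  other ones lie in \<open>supp b\<close> as well, and there are fewer than \<open>k/2\<close> points in
  \<open>supp a \<inter> supp b\<close>. This contradicts \<open>|supp a| = k\<close>. Hence a non-trivial solution has two different
  \<open>\<rho>\<close>-related points, and its retract is smaller. As all hypotheses pass to images under
  surjective homomorphisms (\<open>cyclic_solution_epi\<close>), iterating the retract ends in a trivial
  solution.

  Twisted unions. In a trivial solution all singletons are invariant. The retract of a non-trivial
  solution has more than one point, because a single class would mean that
  \<open>\<sigma>\<^sub>x(y) = \<sigma>\<^sub>y(y) = y\<close> throughout. So induction along retracts, pulling invariant subsets back,
  shows that \<open>X\<close> has a proper non-empty invariant subset if \<open>|X| > 1\<close>
  (\<open>exists_proper_invariant\<close>). Any such subset \<open>Y\<close> and its complement form a generalized twisted
  union: if \<open>y \<in> Y\<close> and \<open>\<sigma>\<^sub>y\<close> moves some \<open>z \<in> X - Y\<close>, then the single cycle of \<open>\<sigma>\<^sub>y\<close> lies in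
  \<open>X - Y\<close>, so conjugation by \<open>\<sigma>\<^sub>y\<close> does not change the action on \<open>Y\<close>, and
  \<open>\<sigma>\<^bsub>\<sigma>\<^sub>y z\<^esub> = \<sigma>\<^sub>z\<close> on \<open>Y\<close> (\<open>sigma_restrict_const\<close>).
\<close>

section \<open>Square free solutions\<close>

locale square_free_solution =
  fixes X :: "'a set" and r :: "'a \<times> 'a \<Rightarrow> 'a \<times> 'a"
  assumes solution: "yb_solution X r"
    and sqfree: "square_free X r"
begin

abbreviation \<sigma> :: "'a \<Rightarrow> 'a \<Rightarrow> 'a" where "\<sigma> \<equiv> sigma r"
abbreviation \<gamma> :: "'a \<Rightarrow> 'a \<Rightarrow> 'a" where "\<gamma> \<equiv> gamma r"

lemma r_eq: "r (x, y) = (\<sigma> x y, \<gamma> y x)"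
  by (simp add: sigma_def gamma_def)

lemma finite_X: "finite X"
  using solution by (simp add: yb_solution_def)

lemma r_closed: "x \<in> X \<Longrightarrow> y \<in> X \<Longrightarrow> r (x, y) \<in> X \<times> X"
  using solution unfolding yb_solution_def by blast

lemma sigma_closed: "x \<in> X \<Longrightarrow> y \<in> X \<Longrightarrow> \<sigma> x y \<in> X"
  and gamma_closed: "x \<in> X \<Longrightarrow> y \<in> X \<Longrightarrow> \<gamma> y x \<in> X"
  using r_closed by (auto simp: r_eq)

lemma sigma_idem: "x \<in> X \<Longrightarrow> \<sigma> x x = x"
  using sqfree by (simp add: square_free_def sigma_def)

lemma sigma_bij:
  assumes "x \<in> X"
  shows "bij_betw (\<sigma> x) X X"
proof -
  have "\<sigma> x ` X = X"
  proof
    show "\<sigma> x ` X \<subseteq> X" using assms sigma_closed by auto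
    show "X \<subseteq> \<sigma> x ` X"
    proof
      fix y assume "y \<in> X"
      then have "\<exists>p. p \<in> X \<times> X \<and> r (x, fst p) = (y, snd p)"
        using solution assms unfolding yb_solution_def by blast
      then show "y \<in> \<sigma> x ` X" by (auto simp: r_eq)
    qed
  qed
  then show ?thesis
    using finite_X by (simp add: bij_betw_def finite_surj_inj)
qed

lemma sigma_inj: "x \<in> X \<Longrightarrow> y \<in> X \<Longrightarrow> z \<in> X \<Longrightarrow> \<sigma> x y = \<sigma> x z \<longleftrightarrow> y = z"
  using sigma_bij[of x] by (auto simp: bij_betw_def inj_on_def)

lemma sigma_surj: "x \<in> X \<Longrightarrow> y \<in> X \<Longrightarrow> \<exists>z \<in> X. y = \<sigma> x z"
  using sigma_bij[of x] by (auto simp: bij_betw_def)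

lemma involutive:
  assumes "x \<in> X" "y \<in> X"
  shows "\<sigma> (\<sigma> x y) (\<gamma> y x) = x" "\<gamma> (\<gamma> y x) (\<sigma> x y) = y"
proof -
  have "r (r (x, y)) = (x, y)"
    using solution assms unfolding yb_solution_def by blast
  then show "\<sigma> (\<sigma> x y) (\<gamma> y x) = x" "\<gamma> (\<gamma> y x) (\<sigma> x y) = y"
    by (simp_all add: r_eq)
qed

lemma braid:
  assumes "x \<in> X" "y \<in> X" "z \<in> X"
  shows "\<sigma> (\<sigma> x y) (\<sigma> (\<gamma> y x) z) = \<sigma> x (\<sigma> y z)"
proof -
  have "r12 r (r23 r (r12 r (x, y, z))) = r23 r (r12 r (r23 r (x, y, z)))"
    using solution assms unfolding yb_solution_def by blast
  then show ?thesis by (simp add: r12_def r23_def r_eq)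
qed

text \<open>
  The braid relation at the triple \<open>(x, y, \<gamma> y x)\<close>: there the square free condition and
  involutivity collapse the left-hand side to \<open>x = \<sigma> x x\<close>.
\<close>

lemma sigma_gamma:
  assumes "x \<in> X" "y \<in> X"
  shows "\<sigma> y (\<gamma> y x) = x"
proof -
  let ?v = "\<gamma> y x"
  have v: "?v \<in> X" using assms gamma_closed by simp
  have "\<sigma> x (\<sigma> y ?v) = \<sigma> (\<sigma> x y) ?v"
    using braid[OF assms v] v by (simp add: sigma_idem)
  also have "\<dots> = \<sigma> x x" using assms by (simp add: involutive sigma_idem)
  finally show ?thesis using assms v sigma_closed sigma_inj by metis
qed

lemma gamma_sigma:
  assumes "x \<in> X" "y \<in> X"
  shows "\<gamma> y (\<sigma> y x) = x"
  using assms sigma_gamma sigma_inj sigma_closed gamma_closed by metis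

text \<open>
  Since \<open>\<gamma> x\<close> inverts \<open>\<sigma> x\<close>, this is the second component of involutivity at
  \<open>(\<sigma> y x, y)\<close>. It says that all elements of a cycle of \<open>\<sigma> y\<close> send \<open>y\<close> to the same point.
\<close>

lemma cyclic_condition:
  assumes "x \<in> X" "y \<in> X"
  shows "\<sigma> (\<sigma> y x) y = \<sigma> x y"
proof -
  let ?u = "\<sigma> y x"
  have u: "?u \<in> X" using assms sigma_closed by simp
  have "\<sigma> x (\<gamma> x (\<sigma> ?u y)) = \<sigma> ?u y"
    using assms u sigma_closed sigma_gamma by simp
  moreover have "\<gamma> x (\<sigma> ?u y) = y"
    using involutive(2)[OF u assms(2)] assms by (simp add: gamma_sigma)
  ultimately show ?thesis by simp
qed

text \<open>
  The braid relation, in which \<open>\<gamma> a x = x\<close> because \<open>\<gamma> a\<close> is the inverse of \<open>\<sigma> a\<close>.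
\<close>

lemma sigma_conjugate:
  assumes "x \<in> X" "a \<in> X" "z \<in> X" "\<sigma> a x = x"
  shows "\<sigma> (\<sigma> x a) (\<sigma> x z) = \<sigma> x (\<sigma> a z)"
  using braid[OF assms(1-3)] gamma_sigma[OF assms(1,2)] assms(4) by simp

definition supp :: "'a \<Rightarrow> 'a set" where
  "supp x = {a \<in> X. \<sigma> x a \<noteq> a}"

lemma suppI: "a \<in> X \<Longrightarrow> \<sigma> x a \<noteq> a \<Longrightarrow> a \<in> supp x"
  and suppD: "a \<in> supp x \<Longrightarrow> a \<in> X" "a \<in> supp x \<Longrightarrow> \<sigma> x a \<noteq> a"
  by (auto simp: supp_def)

lemma finite_supp: "finite (supp x)"
  using finite_X by (simp add: supp_def)

lemma supp_closed: "x \<in> X \<Longrightarrow> a \<in> supp x \<Longrightarrow> \<sigma> x a \<in> supp x"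
  by (auto simp: supp_def sigma_closed sigma_inj)

lemma sigma_image_supp:
  assumes "x \<in> X"
  shows "\<sigma> x ` supp x = supp x"
proof (rule card_subset_eq[OF finite_supp])
  show "\<sigma> x ` supp x \<subseteq> supp x" using assms supp_closed by auto
  show "card (\<sigma> x ` supp x) = card (supp x)"
    using assms by (intro card_image) (auto simp: inj_on_def supp_def sigma_inj)
qed

lemma supp_conjugate:
  assumes "x \<in> X" "a \<in> X" "\<sigma> a x = x"
  shows "supp (\<sigma> x a) = \<sigma> x ` supp a"
proof
  show "\<sigma> x ` supp a \<subseteq> supp (\<sigma> x a)"
    using assms by (auto simp: supp_def sigma_conjugate sigma_closed sigma_inj)
  show "supp (\<sigma> x a) \<subseteq> \<sigma> x ` supp a"
  proof
    fix b assume b: "b \<in> supp (\<sigma> x a)"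
    then obtain c where "c \<in> X" "b = \<sigma> x c" using assms sigma_surj suppD(1) by metis
    with b assms show "b \<in> \<sigma> x ` supp a" by (auto simp: supp_def sigma_conjugate)
  qed
qed

subsection \<open>Invariant subsets\<close>

text \<open>
  Invariance under the generators; by finiteness it implies invariance under the whole group
  (\<open>invariant_subset\<close>).
\<close>

definition sigma_invariant :: "'a set \<Rightarrow> bool" where
  "sigma_invariant Y \<longleftrightarrow> Y \<subseteq> X \<and> (\<forall>x \<in> X. \<forall>y \<in> Y. \<sigma> x y \<in> Y)"

lemma sigma_image_invariant:
  assumes "sigma_invariant Y" "x \<in> X"
  shows "\<sigma> x ` Y = Y"
proof (rule card_subset_eq)
  show "finite Y" using assms finite_X finite_subset by (auto simp: sigma_invariant_def)
  show "\<sigma> x ` Y \<subseteq> Y" using assms by (auto simp: sigma_invariant_def)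
  show "card (\<sigma> x ` Y) = card Y"
    using assms by (intro card_image) (auto simp: inj_on_def sigma_invariant_def sigma_inj subset_iff)
qed

lemma gamma_invariant:
  assumes "sigma_invariant Y" "x \<in> X" "y \<in> Y"
  shows "\<gamma> x y \<in> Y"
proof -
  obtain z where "z \<in> Y" "y = \<sigma> x z" using sigma_image_invariant[OF assms(1,2)] assms(3) by blast
  with assms show ?thesis by (auto simp: gamma_sigma sigma_invariant_def subset_iff)
qed

lemma sigma_invariant_compl:
  assumes "sigma_invariant Y"
  shows "sigma_invariant (X - Y)"
  unfolding sigma_invariant_def
proof (intro conjI ballI)
  fix x y assume x: "x \<in> X" and y: "y \<in> X - Y"
  have "\<sigma> x y \<notin> Y"
    using gamma_invariant[OF assms x, of "\<sigma> x y"] x y gamma_sigma by auto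
  with x y show "\<sigma> x y \<in> X - Y" using sigma_closed by simp
qed simp

lemma subsolution:
  assumes "sigma_invariant Y"
  shows "yb_solution Y r"
proof -
  have sub: "Y \<subseteq> X" using assms by (simp add: sigma_invariant_def)
  have cl: "r p \<in> Y \<times> Y" if "p \<in> Y \<times> Y" for p
    using that assms sub gamma_invariant[OF assms] by (cases p) (auto simp: r_eq sigma_invariant_def)
  have nd: "\<exists>!p. p \<in> Y \<times> Y \<and> r (x, fst p) = (y, snd p)" if xy: "x \<in> Y" "y \<in> Y" for x y
  proof -
    obtain z where z: "z \<in> Y" "y = \<sigma> x z"
      using sigma_image_invariant[OF assms, of x] sub xy by blast
    show ?thesis
    proof (rule ex1I[of _ "(z, \<gamma> z x)"])
      show "(z, \<gamma> z x) \<in> Y \<times> Y \<and> r (x, fst (z, \<gamma> z x)) = (y, snd (z, \<gamma> z x))"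
        using z xy gamma_invariant[OF assms] sub by (auto simp: r_eq)
      fix p assume "p \<in> Y \<times> Y \<and> r (x, fst p) = (y, snd p)"
      then show "p = (z, \<gamma> z x)"
        using z xy sub sigma_inj[of x "fst p" z] by (cases p) (auto simp: r_eq subset_iff)
    qed
  qed
  have sub2: "Y \<times> Y \<subseteq> X \<times> X" and sub3: "Y \<times> Y \<times> Y \<subseteq> X \<times> X \<times> X"
    using sub by auto
  show ?thesis
    unfolding yb_solution_def
  proof (intro conjI)
    show "finite Y" using sub finite_X finite_subset by blast
    show "\<forall>p\<in>Y \<times> Y. r (r p) = p"
      using solution sub2 unfolding yb_solution_def by blast
    show "\<forall>t\<in>Y \<times> Y \<times> Y. r12 r (r23 r (r12 r t)) = r23 r (r12 r (r23 r t))"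
      using solution sub3 unfolding yb_solution_def by blast
    show "\<forall>p\<in>Y \<times> Y. r p \<in> Y \<times> Y" using cl by simp
    show "\<forall>x\<in>Y. \<forall>y\<in>Y. \<exists>!p. p \<in> Y \<times> Y \<and> r (x, fst p) = (y, snd p)"
      using nd by (intro ballI)
  qed
qed

subsection \<open>The permutation group and the retract relation\<close>

lemma iyb_gens: "(\<lambda>x. restrict (\<sigma> x) X) ` X \<subseteq> carrier (BijGroup X)"
  using sigma_bij by (auto simp: BijGroup_def Bij_def bij_betw_restrict_eq)

lemma iyb_subgroup: "subgroup (iyb_group X r) (BijGroup X)"
  unfolding iyb_group_def using group.generate_is_subgroup[OF group_BijGroup iyb_gens] .

lemma iyb_Bij: "g \<in> iyb_group X r \<Longrightarrow> g \<in> Bij X"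
  using subgroup.subset[OF iyb_subgroup] by (auto simp: BijGroup_def)

lemma invariant_subset:
  assumes "sigma_invariant Y"
  shows "invariant_subset X r Y"
proof -
  have sub: "Y \<subseteq> X" using assms by (simp add: sigma_invariant_def)
  have "g y \<in> Y" if "g \<in> generate (BijGroup X) ((\<lambda>x. restrict (\<sigma> x) X) ` X)" "y \<in> Y" for g y
    using that
  proof (induction arbitrary: y)
    case one
    then show ?case using sub by (auto simp: BijGroup_def)
  next
    case (incl h)
    then show ?case using sub assms by (auto simp: sigma_invariant_def)
  next
    case (inv h)
    then obtain x where x: "x \<in> X" "h = restrict (\<sigma> x) X" by auto
    have h: "h \<in> Bij X" using inv iyb_gens by (auto simp: BijGroup_def)
    obtain z where z: "z \<in> Y" "y = \<sigma> x z"
      using sigma_image_invariant[OF assms x(1)] inv by blast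
    have "inv_into X h y = z"
      using h z x sub by (intro inv_into_f_eq) (auto simp: Bij_def bij_betw_def)
    then show ?case using inv h z sub by (auto simp: inv_BijGroup)
  next
    case (eng h1 h2)
    then have "h1 \<in> Bij X" "h2 \<in> Bij X"
      using iyb_Bij by (simp_all add: iyb_group_def)
    with eng sub show ?case by (auto simp: BijGroup_def compose_def)
  qed
  then show ?thesis using sub by (simp add: invariant_subset_def iyb_group_def)
qed

definition same_orbit :: "'a \<Rightarrow> 'a \<Rightarrow> bool" where
  "same_orbit x y \<longleftrightarrow> (\<exists>g \<in> iyb_group X r. g x = y)"

lemma same_orbit_refl: "x \<in> X \<Longrightarrow> same_orbit x x"
  unfolding same_orbit_def using subgroup.one_closed[OF iyb_subgroup]
  by (intro bexI[of _ "\<one>\<^bsub>BijGroup X\<^esub>"]) (auto simp: BijGroup_def)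

lemma same_orbit_sym:
  assumes "x \<in> X" "same_orbit x y"
  shows "same_orbit y x"
proof -
  obtain g where g: "g \<in> iyb_group X r" "g x = y" using assms by (auto simp: same_orbit_def)
  have b: "g \<in> Bij X" using g iyb_Bij by blast
  have "y \<in> X" using b g assms by (auto simp: Bij_def bij_betw_def)
  moreover have "inv_into X g y = x"
    using b g assms by (intro inv_into_f_eq) (auto simp: Bij_def bij_betw_def)
  ultimately have "(inv\<^bsub>BijGroup X\<^esub> g) y = x" using b by (simp add: inv_BijGroup)
  then show ?thesis
    using subgroup.m_inv_closed[OF iyb_subgroup g(1)] by (auto simp: same_orbit_def)
qed

lemma same_orbit_trans:
  assumes "x \<in> X" "same_orbit x y" "same_orbit y z"
  shows "same_orbit x z"
proof -
  obtain g h where g: "g \<in> iyb_group X r" "g x = y" and h: "h \<in> iyb_group X r" "h y = z"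
    using assms by (auto simp: same_orbit_def)
  have "(h \<otimes>\<^bsub>BijGroup X\<^esub> g) x = z"
    using assms g h iyb_Bij by (simp add: BijGroup_def compose_def)
  then show ?thesis
    using subgroup.m_closed[OF iyb_subgroup h(1) g(1)] by (auto simp: same_orbit_def)
qed

lemma same_orbit_sigma:
  assumes "x \<in> X" "z \<in> X"
  shows "same_orbit x (\<sigma> z x)"
proof -
  have "restrict (\<sigma> z) X \<in> iyb_group X r"
    using assms unfolding iyb_group_def by (auto intro: generate.incl)
  then show ?thesis using assms by (auto simp: same_orbit_def intro: bexI[of _ "restrict (\<sigma> z) X"])
qed

lemma same_orbit_gamma:
  assumes "x \<in> X" "z \<in> X"
  shows "same_orbit x (\<gamma> z x)"
  using same_orbit_sym[OF _ same_orbit_sigma[of "\<gamma> z x" z]] assms gamma_closed sigma_gamma by simp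

lemma rho_iff:
  "(x, y) \<in> rho X r \<longleftrightarrow> x \<in> X \<and> y \<in> X \<and> same_orbit x y \<and> (\<forall>z \<in> X. \<sigma> x z = \<sigma> y z)"
  by (auto simp: rho_def same_orbit_def)

lemma equiv_rho: "equiv X (rho X r)"
proof (rule equivI)
  show "refl_on X (rho X r)" by (rule refl_onI) (auto simp: rho_iff same_orbit_refl)
  show "sym (rho X r)" by (rule symI) (auto simp: rho_iff intro: same_orbit_sym)
  show "trans (rho X r)" by (rule transI) (auto simp: rho_iff intro: same_orbit_trans)
  show "rho X r \<subseteq> X \<times> X" by (auto simp: rho_iff)
qed

text \<open>
  In \<open>\<sigma> x \<circ> \<sigma> y = \<sigma> (\<sigma> x y) \<circ> \<sigma> (\<gamma> y x)\<close> three of the permutations determine the fourth, and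
  changing \<open>x\<close> within its class does not affect the point \<open>\<sigma> x y\<close>, nor does changing \<open>y\<close> affect
  \<open>\<gamma> y x\<close>, as \<open>\<gamma> y\<close> is the inverse of \<open>\<sigma> y\<close>.
\<close>

lemma rho_congruence:
  assumes "(x, x') \<in> rho X r" "(y, y') \<in> rho X r"
  shows "(\<sigma> x y, \<sigma> x' y') \<in> rho X r" "(\<gamma> y x, \<gamma> y' x') \<in> rho X r"
proof -
  have X: "x \<in> X" "x' \<in> X" "y \<in> X" "y' \<in> X" using assms by (auto simp: rho_iff)
  have sx: "\<sigma> x z = \<sigma> x' z" and sy: "\<sigma> y z = \<sigma> y' z" if "z \<in> X" for z
    using assms that by (auto simp: rho_iff)
  have gy: "\<gamma> y z = \<gamma> y' z" if "z \<in> X" for z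
    using that X sy sigma_gamma gamma_sigma gamma_closed by metis
  have "same_orbit (\<sigma> x y) (\<sigma> x y')"
    using X assms(2) same_orbit_trans same_orbit_sym same_orbit_sigma sigma_closed
    unfolding rho_iff by meson
  moreover have "\<sigma> (\<sigma> x y) z = \<sigma> (\<sigma> x y') z" if z: "z \<in> X" for z
  proof -
    obtain w where w: "w \<in> X" "z = \<sigma> (\<gamma> y x) w"
      using sigma_surj X z gamma_closed by metis
    have "\<sigma> (\<sigma> x y) z = \<sigma> x (\<sigma> y' w)" using braid[of x y w] w X sy by simp
    then show ?thesis using braid[of x y' w] w X gy by simp
  qed
  ultimately show "(\<sigma> x y, \<sigma> x' y') \<in> rho X r"
    using X sigma_closed sx by (simp add: rho_iff)
  have "same_orbit (\<gamma> y x) (\<gamma> y x')"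
    using X assms(1) same_orbit_trans same_orbit_sym same_orbit_gamma gamma_closed
    unfolding rho_iff by meson
  moreover have "\<sigma> (\<gamma> y x) z = \<sigma> (\<gamma> y x') z" if z: "z \<in> X" for z
  proof -
    have "\<sigma> (\<sigma> x y) (\<sigma> (\<gamma> y x) z) = \<sigma> (\<sigma> x y) (\<sigma> (\<gamma> y x') z)"
      using braid[of x y z] braid[of x' y z] X z sx sigma_closed by simp
    then show ?thesis using sigma_inj X z gamma_closed sigma_closed by metis
  qed
  ultimately show "(\<gamma> y x, \<gamma> y' x') \<in> rho X r"
    using X gamma_closed gy by (simp add: rho_iff)
qed

lemma rbar_classes:
  assumes "x \<in> X" "y \<in> X"
  shows "rbar X r (rho X r `` {x}, rho X r `` {y}) =
    (rho X r `` {\<sigma> x y}, rho X r `` {\<gamma> y x})"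
proof -
  let ?F = "\<lambda>p. (rho X r `` {fst (r p)}, rho X r `` {snd (r p)})"
  let ?C = "rho X r `` {x}" and ?D = "rho X r `` {y}"
  have "?F p = (rho X r `` {\<sigma> x y}, rho X r `` {\<gamma> y x})" if p_in: "p \<in> ?C \<times> ?D" for p
  proof -
    obtain x' y' where p: "p = (x', y')" "(x, x') \<in> rho X r" "(y, y') \<in> rho X r"
      using p_in by auto
    then show ?thesis
      using equiv_class_eq[OF equiv_rho rho_congruence(1)[OF p(2,3)]]
        equiv_class_eq[OF equiv_rho rho_congruence(2)[OF p(2,3)]]
      by (simp add: r_eq)
  qed
  moreover have "(x, y) \<in> ?C \<times> ?D" using assms by (simp add: rho_iff same_orbit_refl)
  ultimately have "?F ` (?C \<times> ?D) = {(rho X r `` {\<sigma> x y}, rho X r `` {\<gamma> y x})}"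
    by blast
  then show ?thesis by (simp add: rbar_def)
qed

end

section \<open>Solutions whose permutations are cycles\<close>

locale cyclic_solution = square_free_solution +
  assumes cyclic: "x \<in> X \<Longrightarrow> cyclic_permutation X (sigma r x)"
begin

text \<open>
  The moved points of \<open>\<sigma> x\<close> form one orbit, so a property that \<open>\<sigma> x\<close> preserves spreads from
  one of them to all others.
\<close>

lemma cycle_induct [consumes 3, case_names start step]:
  assumes "x \<in> X" "a \<in> supp x" "b \<in> supp x"
    and start: "P a" and step: "\<And>c. c \<in> supp x \<Longrightarrow> P c \<Longrightarrow> P (\<sigma> x c)"
  shows "P b"
proof -
  obtain S where S: "cyclic_on (\<sigma> x) S" "\<forall>c \<in> X - S. \<sigma> x c = c"
    using cyclic[OF assms(1)] by (auto simp: cyclic_permutation_def)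
  have "a \<in> S" "b \<in> S" using S assms by (auto simp: supp_def)
  then have "b \<in> orbit (\<sigma> x) a" using S by (auto simp: cyclic_on_alldef)
  then have "b \<in> supp x \<and> P b"
  proof induction
    case base
    show ?case using assms(1,2) start step supp_closed by simp
  next
    case (step c)
    then show ?case using assms(1,5) supp_closed by simp
  qed
  then show ?thesis by simp
qed

lemma sigma_eq_of_agree_on_supp:
  assumes "x \<in> X" "y \<in> X" "supp x \<noteq> {}" "\<And>a. a \<in> supp x \<Longrightarrow> \<sigma> y a = \<sigma> x a" "w \<in> X"
  shows "\<sigma> y w = \<sigma> x w"
proof -
  obtain a where a: "a \<in> supp x" using assms(3) by blast
  then have ay: "a \<in> supp y" using assms(4) by (auto simp: supp_def)
  have "b \<in> supp x" if "b \<in> supp y" for b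
    using assms(2) ay that by (induction rule: cycle_induct) (use a assms supp_closed in auto)
  then have "\<sigma> y w = w" if "w \<notin> supp x" using that suppI[OF assms(5), of y] by blast
  then show ?thesis using assms(4)[of w] suppI[OF assms(5), of x] by metis
qed

text \<open>
  By the cyclic condition, every \<open>y\<close> in the cycle of \<open>x\<close> under \<open>\<sigma> z\<close> sends \<open>z\<close> to \<open>\<sigma> x z\<close>;
  applied a second time, with the roles exchanged, it shows that \<open>\<sigma> x z\<close> and \<open>z\<close> act alike on each
  such \<open>y\<close>. These \<open>y\<close> exhaust \<open>supp z\<close>.
\<close>

lemma sigma_eq_of_mutual_move:
  assumes "x \<in> X" "z \<in> X" "\<sigma> z x \<noteq> x" "\<sigma> x z \<noteq> z" "w \<in> X"
  shows "\<sigma> (\<sigma> x z) w = \<sigma> z w"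
proof (rule sigma_eq_of_agree_on_supp[OF assms(2) _ _ _ assms(5)])
  show "\<sigma> x z \<in> X" using assms sigma_closed by simp
  have x: "x \<in> supp z" using assms suppI by simp
  then show "supp z \<noteq> {}" by auto
  fix y assume y: "y \<in> supp z"
  have "\<sigma> y z = \<sigma> x z"
    using assms(2) x y
    by (induction rule: cycle_induct) (simp_all add: cyclic_condition assms suppD)
  then show "\<sigma> (\<sigma> x z) y = \<sigma> z y"
    using cyclic_condition[of z y] assms y suppD by metis
qed

end

text \<open>
  The hypothetical situation that the counting argument refutes, up to trivial solutions.
\<close>

locale irretractable_cyclic_solution = cyclic_solution +
  assumes separated:
    "x \<in> X \<Longrightarrow> a \<in> X \<Longrightarrow> \<sigma> x a \<noteq> a \<Longrightarrow> \<exists>w \<in> X. \<sigma> (\<sigma> x a) w \<noteq> \<sigma> a w"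
begin

lemma moves_asym:
  assumes "x \<in> X" "a \<in> supp x"
  shows "x \<notin> supp a"
  using sigma_eq_of_mutual_move[of x a] separated[of x a] assms by (auto simp: supp_def)

lemma supp_sigma:
  assumes "x \<in> X" "a \<in> supp x"
  shows "supp (\<sigma> x a) = \<sigma> x ` supp a"
  using supp_conjugate[of x a] moves_asym[OF assms] assms by (auto simp: supp_def)

text \<open>
  Permutations with disjoint supports commute, and conjugating \<open>\<sigma> a\<close> by \<open>\<sigma> x\<close> would then give
  \<open>\<sigma> (\<sigma> x a) = \<sigma> a\<close>.
\<close>

lemma supp_meet:
  assumes "x \<in> X" "a \<in> supp x"
  shows "supp x \<inter> supp a \<noteq> {}"
proof
  assume disj: "supp x \<inter> supp a = {}"
  have a: "a \<in> X" "\<sigma> a x = x" using assms moves_asym suppD suppI by blast+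
  have "\<sigma> (\<sigma> x a) w = \<sigma> a w" if w: "w \<in> X" for w
  proof -
    have eq: "\<sigma> (\<sigma> x a) (\<sigma> x u) = \<sigma> x (\<sigma> a u)" if "u \<in> X" for u
      using sigma_conjugate a assms(1) that by simp
    show ?thesis
    proof (cases "w \<in> supp x")
      case True
      then obtain v where v: "v \<in> supp x" "w = \<sigma> x v"
        using sigma_image_supp assms(1) by blast
      have "\<sigma> a v = v" "\<sigma> a w = w" using v True disj suppI suppD by blast+
      then show ?thesis using eq[of v] v suppD(1) by simp
    next
      case False
      then have "\<sigma> a w \<notin> supp x"
        using disj w supp_closed[OF a(1), of w] suppI[of w a] by (cases "\<sigma> a w = w") auto
      then have "\<sigma> x (\<sigma> a w) = \<sigma> a w" using suppI sigma_closed a w by blast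
      then show ?thesis using eq[of w] w False suppI by force
    qed
  qed
  then show False using separated[of x a] assms a suppD by blast
qed

lemma inj_on_sigma: "x \<in> X \<Longrightarrow> A \<subseteq> X \<Longrightarrow> inj_on (\<sigma> x) A"
  by (auto simp: inj_on_def sigma_inj subset_iff)

text \<open>
  Passing from \<open>a\<close> to \<open>\<sigma> x a\<close> applies \<open>\<sigma> x\<close> to \<open>supp a\<close>, while \<open>\<sigma> x\<close> maps \<open>supp x\<close> to itself
  and fixes all points outside it.
\<close>

lemma supp_on_cycle:
  assumes x: "x \<in> X" and a: "a \<in> supp x" and b: "b \<in> supp x"
  shows card_supp_on_cycle: "card (supp b) = card (supp a)"
    and card_inter_on_cycle: "card (supp x \<inter> supp b) = card (supp x \<inter> supp a)"
    and supp_diff_on_cycle: "supp b - supp x = supp a - supp x"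
proof -
  have sub: "supp c \<subseteq> X" for c by (auto simp: supp_def)
  have "card (supp b) = card (supp a) \<and> card (supp x \<inter> supp b) = card (supp x \<inter> supp a)
    \<and> supp b - supp x = supp a - supp x"
    using x a b
  proof (induction rule: cycle_induct)
    case (step c)
    have 1: "supp (\<sigma> x c) = \<sigma> x ` supp c" using supp_sigma x step by simp
    have 2: "supp x \<inter> supp (\<sigma> x c) = \<sigma> x ` (supp x \<inter> supp c)"
      using 1 sigma_image_supp[OF x] inj_on_image_Int[OF inj_on_sigma[OF x order.refl] sub sub]
      by simp
    have 3: "supp (\<sigma> x c) - supp x = \<sigma> x ` (supp c - supp x)"
      using 1 sigma_image_supp[OF x]
        inj_on_image_set_diff[OF inj_on_sigma[OF x order.refl], of "supp c" "supp x"] sub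
      by (simp add: Diff_subset[THEN subset_trans])
    have "\<sigma> x ` (supp c - supp x) = (\<lambda>y. y) ` (supp c - supp x)"
      by (rule image_cong) (auto simp: supp_def)
    then have 4: "supp (\<sigma> x c) - supp x = supp c - supp x" using 3 by simp
    show ?case
      using 1 2 4 step sub card_image[OF inj_on_sigma[OF x, of "supp c"]]
        card_image[OF inj_on_sigma[OF x le_infI1[OF sub]]] by simp
  qed simp
  then show "card (supp b) = card (supp a)"
    "card (supp x \<inter> supp b) = card (supp x \<inter> supp a)"
    "supp b - supp x = supp a - supp x" by simp_all
qed

text \<open>
  The pairs in \<open>supp x\<close> of which the first moves the second form an oriented graph on \<open>k\<close>
  vertices with constant out-degree \<open>d\<close>. Its \<open>k d\<close> edges, their \<open>k d\<close> reversals and the \<open>k\<close>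
  loops are pairwise different, so \<open>2 k d + k \<le> k\<^sup>2\<close>.
\<close>

lemma card_inter_less_half:
  assumes x: "x \<in> X" and a: "a \<in> supp x"
  shows "2 * card (supp x \<inter> supp a) < card (supp x)"
proof -
  let ?A = "supp x"
  let ?k = "card ?A" and ?d = "card (?A \<inter> supp a)"
  define E where "E = (SIGMA b:?A. ?A \<inter> supp b)"
  have finE: "finite E" using finite_supp by (simp add: E_def)
  have "card E = (\<Sum>b\<in>?A. card (?A \<inter> supp b))"
    unfolding E_def using finite_supp by (intro card_SigmaI) auto
  also have "\<dots> = (\<Sum>b\<in>?A. ?d)"
    using card_inter_on_cycle[OF x a] by (rule sum.cong[OF refl])
  finally have cE: "card E = ?k * ?d" by simp
  have disj: "E \<inter> E\<inverse> = {}"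
    using moves_asym suppD(1) by (auto simp: E_def)
  have disj': "(E \<union> E\<inverse>) \<inter> Id_on ?A = {}"
    using sigma_idem by (auto simp: E_def supp_def)
  have "card (E \<union> E\<inverse> \<union> Id_on ?A) = card E + card (E\<inverse>) + card (Id_on ?A)"
    using disj disj' finE finite_supp by (simp add: card_Un_disjoint Id_on_def)
  also have "\<dots> = 2 * (?k * ?d) + ?k"
    using cE by (simp add: Id_on_def card_inverse card_UN_disjoint finite_supp)
  finally have "card (E \<union> E\<inverse> \<union> Id_on ?A) = 2 * (?k * ?d) + ?k" .
  moreover have "card (E \<union> E\<inverse> \<union> Id_on ?A) \<le> card (?A \<times> ?A)"
    by (rule card_mono) (auto simp: E_def finite_supp)
  ultimately have "?k * (2 * ?d + 1) \<le> ?k * ?k"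
    by (simp add: algebra_simps card_cartesian_product)
  moreover have "?k > 0" using a finite_supp by (auto simp: card_gt_0_iff)
  ultimately show ?thesis by (metis nat_mult_le_cancel1 Suc_eq_plus1 Suc_le_eq)
qed

text \<open>
  The set \<open>supp a - supp y\<close> contains more than half of \<open>supp a\<close> and is part of
  \<open>supp a \<inter> supp b\<close>, which contains less than half of \<open>supp a\<close>.
\<close>

lemma sigma_trivial:
  assumes "x \<in> X" "y \<in> X"
  shows "\<sigma> x y = y"
proof (rule ccontr)
  assume "\<sigma> x y \<noteq> y"
  then have y: "y \<in> supp x" using assms suppI by simp
  \<comment> \<open>As \<open>y\<close> and \<open>a\<close> both lie in \<open>supp x\<close>, the sets \<open>supp y\<close> and \<open>supp a\<close> are equally large.\<close>
  obtain a where a: "a \<in> supp x" "a \<in> supp y" using supp_meet[OF assms(1) y] by auto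
  obtain b where b: "b \<in> supp y" "b \<in> supp a" using supp_meet[OF assms(2) a(2)] by auto
  have aX: "a \<in> X" using a suppD by simp
  have "supp a - supp y = supp b - supp y"
    using supp_diff_on_cycle[OF assms(2) b(1) a(2)] by simp
  then have "supp a - supp y \<subseteq> supp a \<inter> supp b" by blast
  then have "card (supp a - supp y) \<le> card (supp a \<inter> supp b)"
    by (intro card_mono) (auto simp: finite_supp)
  moreover have "card (supp a) = card (supp y \<inter> supp a) + card (supp a - supp y)"
    using card_Int_Diff[OF finite_supp, of a "supp y"] by (simp add: Int_commute)
  moreover have "card (supp y) = card (supp a)"
    using card_supp_on_cycle[OF assms(1) a(1) y] .
  ultimately show False
    using card_inter_less_half[OF assms(2) a(2)] card_inter_less_half[OF aX b(2)] by linarith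
qed

end

context cyclic_solution
begin

lemma exists_retractable_pair:
  assumes "x \<in> X" "y \<in> X" "\<sigma> x y \<noteq> y"
  shows "\<exists>a b. (a, b) \<in> rho X r \<and> a \<noteq> b"
proof -
  have "\<not> irretractable_cyclic_solution X r"
    using irretractable_cyclic_solution.sigma_trivial assms by metis
  then obtain z a where za: "z \<in> X" "a \<in> X" "\<sigma> z a \<noteq> a"
      "\<forall>w \<in> X. \<sigma> (\<sigma> z a) w = \<sigma> a w"
    using cyclic_solution_axioms
    unfolding irretractable_cyclic_solution_def irretractable_cyclic_solution_axioms_def by blast
  then have "(a, \<sigma> z a) \<in> rho X r"
    using same_orbit_sigma sigma_closed by (simp add: rho_iff)
  with za show ?thesis by metis
qed

text \<open>
  Only the case in which \<open>\<sigma> y\<close> moves \<open>z\<close> and \<open>\<sigma> z\<close> fixes \<open>y\<close> needs work. Then \<open>\<sigma> y\<close> conjugates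
  \<open>\<sigma> z\<close> to \<open>\<sigma> (\<sigma> y z)\<close>; moreover the cycle \<open>\<sigma> y\<close> contains \<open>z\<close>, hence lies outside \<open>Y\<close>, and so
  the conjugation changes nothing on \<open>Y\<close>.
\<close>

lemma sigma_restrict_const:
  assumes "sigma_invariant Y" "y \<in> Y" "z \<in> X - Y" "w \<in> Y"
  shows "\<sigma> (\<sigma> y z) w = \<sigma> z w"
proof -
  have X: "y \<in> X" "z \<in> X" "w \<in> X" using assms by (auto simp: sigma_invariant_def)
  consider "\<sigma> y z = z" | "\<sigma> y z \<noteq> z" "\<sigma> z y \<noteq> y" | "\<sigma> y z \<noteq> z" "\<sigma> z y = y" by blast
  then show ?thesis
  proof cases
    case 2
    then show ?thesis using sigma_eq_of_mutual_move X by simp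
  next
    case 3
    have conj: "\<sigma> (\<sigma> y z) (\<sigma> y v) = \<sigma> y (\<sigma> z v)" if "v \<in> X" for v
      using sigma_conjugate X 3 that by simp
    have zy: "z \<in> supp y" using 3 X suppI by simp
    have "b \<in> X - Y" if "b \<in> supp y" for b
      using X(1) zy that
      by (induction rule: cycle_induct)
        (use assms X sigma_invariant_compl[OF assms(1)] in \<open>auto simp: sigma_invariant_def\<close>)
    then have "\<sigma> y v = v" if "v \<in> Y" for v
      using that assms(1) suppI by (auto simp: sigma_invariant_def)
    then show ?thesis using conj[of w] assms X by (simp add: sigma_invariant_def)
  qed simp
qed

lemma generalized_twisted_union_of_invariant:
  assumes "sigma_invariant Y" "Y \<noteq> {}" "Y \<noteq> X"
  shows "generalized_twisted_union X r"
proof -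
  let ?Z = "X - Y"
  have sub: "Y \<subseteq> X" using assms by (simp add: sigma_invariant_def)
  have invZ: "sigma_invariant ?Z" using assms sigma_invariant_compl by simp
  have s: "\<sigma> (\<gamma> y z) w = \<sigma> z w" if "y \<in> Y" "z \<in> ?Z" "w \<in> Y" for y z w
  proof -
    have "\<gamma> y z \<in> ?Z" using gamma_invariant[OF invZ] that sub by blast
    then show ?thesis
      using sigma_restrict_const[OF assms(1) that(1) _ that(3), of "\<gamma> y z"]
        sigma_gamma[of z y] that sub by auto
  qed
  have g: "\<gamma> (\<sigma> z y) w = \<gamma> y w" if "y \<in> Y" "z \<in> ?Z" "w \<in> ?Z" for y z w
  proof -
    have X: "y \<in> X" "z \<in> X" "w \<in> X" "\<sigma> z y \<in> X" using that sub sigma_closed by auto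
    have v: "\<gamma> (\<sigma> z y) w \<in> ?Z" using gamma_invariant[OF invZ X(4) that(3)] .
    have "\<sigma> y (\<gamma> (\<sigma> z y) w) = \<sigma> (\<sigma> z y) (\<gamma> (\<sigma> z y) w)"
      using sigma_restrict_const[OF invZ that(2) _ v, of y] that sub by auto
    also have "\<dots> = w" using sigma_gamma X by simp
    finally show ?thesis using gamma_sigma[of "\<gamma> (\<sigma> z y) w" y] X v by simp
  qed
  show ?thesis
    unfolding generalized_twisted_union_def
    by (rule exI[of _ Y], rule exI[of _ ?Z])
      (use assms sub invZ s g invariant_subset subsolution in auto)
qed

end

section \<open>Homomorphic images and the retract\<close>

text \<open>
  Surjective homomorphisms of solutions. Both the passage from \<open>X\<close> to its copy in the type of
  iterated classes and the passage from a solution to its retract are of this kind.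
\<close>

definition solution_epi ::
  "('a \<Rightarrow> 'b) \<Rightarrow> 'a set \<Rightarrow> ('a \<times> 'a \<Rightarrow> 'a \<times> 'a) \<Rightarrow> 'b set \<Rightarrow> ('b \<times> 'b \<Rightarrow> 'b \<times> 'b) \<Rightarrow> bool" where
  "solution_epi f X r Y s \<longleftrightarrow>
     f ` X = Y \<and> (\<forall>x \<in> X. \<forall>y \<in> X. s (f x, f y) = map_prod f f (r (x, y)))"

lemma sigma_epi: "solution_epi f X r Y s \<Longrightarrow> x \<in> X \<Longrightarrow> y \<in> X \<Longrightarrow> sigma s (f x) (f y) = f (sigma r x y)"
  by (auto simp: solution_epi_def sigma_def)

lemma trivial_epi:
  assumes "solution_epi f X r Y s" "trivial_solution X r"
  shows "trivial_solution Y s"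
  using assms by (auto simp: solution_epi_def trivial_solution_def)

lemma (in square_free_solution) trivial_iff:
  "trivial_solution X r \<longleftrightarrow> (\<forall>x \<in> X. \<forall>y \<in> X. \<sigma> x y = y)"
proof -
  have "\<gamma> y x = x" if "\<forall>x \<in> X. \<forall>y \<in> X. \<sigma> x y = y" "x \<in> X" "y \<in> X" for x y
    using gamma_sigma[of x y] that by simp
  then show ?thesis by (auto simp: trivial_solution_def r_eq)
qed

text \<open>
  Equations are inherited by images, and the induced maps \<open>\<sigma>\<close> are surjections of a finite set,
  hence bijections. The image of the support of a cycle is permuted cyclically, and all points outside it are
  images of fixed points.
\<close>

lemma (in cyclic_solution) cyclic_solution_epi:
  assumes f: "solution_epi f X r Y s"
  shows "cyclic_solution Y s"
proof -
  have Y: "Y = f ` X" and s: "\<And>x y. x \<in> X \<Longrightarrow> y \<in> X \<Longrightarrow> s (f x, f y) = (f (\<sigma> x y), f (\<gamma> y x))"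
    using f by (auto simp: solution_epi_def r_eq)
  have sig: "\<And>x y. x \<in> X \<Longrightarrow> y \<in> X \<Longrightarrow> sigma s (f x) (f y) = f (\<sigma> x y)"
    using s by (simp add: sigma_def)
  have fin: "finite Y" using Y finite_X by simp
  have bij: "bij_betw (sigma s y) Y Y" if y: "y \<in> Y" for y
  proof -
    obtain x where x: "x \<in> X" "y = f x" using y Y by auto
    have "sigma s y ` Y = f ` \<sigma> x ` X"
      using x by (auto simp: Y sig image_iff)
    also have "\<dots> = Y" using sigma_bij[OF x(1)] by (simp add: bij_betw_def Y)
    finally show ?thesis using fin by (simp add: bij_betw_def finite_surj_inj)
  qed
  have "yb_solution Y s"
    unfolding yb_solution_def
  proof (intro conjI ballI fin)
    fix p assume "p \<in> Y \<times> Y"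
    then obtain x y where p: "x \<in> X" "y \<in> X" "p = (f x, f y)" using Y by auto
    then show "s p \<in> Y \<times> Y" "s (s p) = p"
      using s sigma_closed gamma_closed by (auto simp: Y involutive)
  next
    fix x y assume xy: "x \<in> Y" "y \<in> Y"
    obtain k where k: "k \<in> Y" "sigma s x k = y"
      using bij[OF xy(1)] xy(2) by (metis bij_betw_def image_iff)
    have cl: "snd (s (x, k)) \<in> Y"
      using xy k s gamma_closed by (auto simp: Y)
    show "\<exists>!p. p \<in> Y \<times> Y \<and> s (x, fst p) = (y, snd p)"
    proof (rule ex1I[of _ "(k, snd (s (x, k)))"])
      show "(k, snd (s (x, k))) \<in> Y \<times> Y \<and> s (x, fst (k, snd (s (x, k)))) = (y, snd (k, snd (s (x, k))))"
        using k cl by (auto simp: sigma_def prod_eq_iff)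
      fix p assume p: "p \<in> Y \<times> Y \<and> s (x, fst p) = (y, snd p)"
      then have "fst p = k"
        using k bij[OF xy(1)] by (auto simp: sigma_def bij_betw_def inj_on_def)
      then show "p = (k, snd (s (x, k)))" using p by (auto simp: prod_eq_iff)
    qed
  next
    fix t assume "t \<in> Y \<times> Y \<times> Y"
    then obtain x y z where t: "x \<in> X" "y \<in> X" "z \<in> X" "t = (f x, f y, f z)" using Y by auto
    define F where "F = (\<lambda>(x, y, z). (f x, f y, f z))"
    have 12: "r12 s (F u) = F (r12 r u)" "r12 r u \<in> X \<times> X \<times> X"
      and 23: "r23 s (F u) = F (r23 r u)" "r23 r u \<in> X \<times> X \<times> X" if "u \<in> X \<times> X \<times> X" for u
      using that s sigma_closed gamma_closed by (auto simp: F_def r12_def r23_def r_eq)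
    have u: "(x, y, z) \<in> X \<times> X \<times> X" using t by simp
    then have "r12 r (r23 r (r12 r (x, y, z))) = r23 r (r12 r (r23 r (x, y, z)))"
      using solution unfolding yb_solution_def by blast
    moreover have "t = F (x, y, z)" using t(4) by (simp add: F_def)
    ultimately show "r12 s (r23 s (r12 s t)) = r23 s (r12 s (r23 s t))"
      using u by (simp only: 12 23)
  qed
  moreover have "square_free Y s"
    using s sqfree by (auto simp: square_free_def Y r_eq)
  moreover have "cyclic_permutation Y (sigma s y)" if y: "y \<in> Y" for y
  proof -
    obtain x where x: "x \<in> X" "y = f x" using y Y by auto
    obtain S where S: "S \<subseteq> X" "cyclic_on (\<sigma> x) S" "\<forall>c \<in> X - S. \<sigma> x c = c"
      using cyclic[OF x(1)] by (auto simp: cyclic_permutation_def)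
    have "cyclic_on (sigma s y) (f ` S)"
      using S(1) x by (intro cyclic_on_image[OF S(2)]) (auto simp: sig)
    moreover have "f ` S \<subseteq> Y" using S Y by auto
    moreover have "sigma s y c = c" if c: "c \<in> Y - f ` S" for c
    proof -
      obtain d where "d \<in> X - S" "c = f d" using c Y by blast
      then show ?thesis using S(3) x by (simp add: sig)
    qed
    ultimately show ?thesis using bij[OF y] by (auto simp: cyclic_permutation_def)
  qed
  ultimately show ?thesis by unfold_locales
qed

lemma (in square_free_solution) sigma_invariant_vimage:
  assumes f: "solution_epi f X r Y s" and "square_free_solution Y s"
    and "square_free_solution.sigma_invariant Y s V" "V \<noteq> {}" "V \<noteq> Y"
  shows "\<exists>U. sigma_invariant U \<and> U \<noteq> {} \<and> U \<noteq> X"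
proof (intro exI conjI)
  have Y: "Y = f ` X" using f by (simp add: solution_epi_def)
  have V: "V \<subseteq> Y" "\<forall>x \<in> Y. \<forall>y \<in> V. sigma s x y \<in> V"
    using assms square_free_solution.sigma_invariant_def by blast+
  let ?U = "{x \<in> X. f x \<in> V}"
  show "sigma_invariant ?U"
    using V Y sigma_closed by (auto simp: sigma_invariant_def simp flip: sigma_epi[OF f])
  show "?U \<noteq> {}" "?U \<noteq> X" using V assms(4,5) Y by auto
qed

lemma transport_epi:
  assumes "inj_on f X" "transport f (X, r) = (Y, s)"
  shows "solution_epi f X r Y s"
  using assms by (auto simp: solution_epi_def transport_def)

text \<open>
  The projection onto the retract, with the class of \<open>x\<close> recorded as in \<open>Ret\<close>.
\<close>

definition retract_map :: "'a elt set \<Rightarrow> ('a elt \<times> 'a elt \<Rightarrow> 'a elt \<times> 'a elt) \<Rightarrow> 'a elt \<Rightarrow> 'a elt" where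
  "retract_map X r x = Cls (Abs_fset (rho X r `` {x}))"

text \<open>
  Classes are finite, so recording them through \<open>Abs_fset\<close> loses nothing, and \<open>rbar\<close> may be
  computed on representatives because \<open>rho\<close> is a congruence.
\<close>

lemma retract_epi:
  assumes "square_free_solution X r" "Ret (X, r) = (Y, s)"
  shows "solution_epi (retract_map X r) X r Y s"
    and "x \<in> X \<Longrightarrow> y \<in> X \<Longrightarrow> retract_map X r x = retract_map X r y \<longleftrightarrow> (x, y) \<in> rho X r"
proof -
  interpret square_free_solution X r by fact
  let ?h = "\<lambda>C. Cls (Abs_fset C)"
  have fin: "finite (rho X r `` {x})" for x
    using finite_X by (rule finite_subset[rotated]) (auto simp: rho_iff)
  have inj: "?h (rho X r `` {x}) = ?h (rho X r `` {y}) \<longleftrightarrow> rho X r `` {x} = rho X r `` {y}" for x y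
    using fin by (simp add: Abs_fset_inject)
  then have injq: "inj_on ?h (X // rho X r)"
    by (intro inj_onI) (auto elim!: quotientE)
  have inv: "inv_into (X // rho X r) ?h (retract_map X r x) = rho X r `` {x}" if "x \<in> X" for x
    unfolding retract_map_def using that by (intro inv_into_f_eq[OF injq]) (auto intro: quotientI)
  show "solution_epi (retract_map X r) X r Y s"
    unfolding solution_epi_def
  proof (intro conjI ballI)
    show "retract_map X r ` X = Y"
      using assms(2) by (auto simp: Ret_def transport_def retract_map_def quotient_def)
    fix x y assume "x \<in> X" "y \<in> X"
    then show "s (retract_map X r x, retract_map X r y) = map_prod (retract_map X r) (retract_map X r) (r (x, y))"
      using assms(2) by (auto simp: Ret_def transport_def inv rbar_classes r_eq)
        (simp_all add: retract_map_def)
  qed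
  show "retract_map X r x = retract_map X r y \<longleftrightarrow> (x, y) \<in> rho X r" if "x \<in> X" "y \<in> X"
    unfolding retract_map_def inj using that eq_equiv_class_iff[OF equiv_rho] by simp
qed

lemma card_retract_less:
  assumes "cyclic_solution X r" "Ret (X, r) = (Y, s)" "\<not> trivial_solution X r"
  shows "card Y < card X"
proof -
  interpret cyclic_solution X r by fact
  note epi = retract_epi[OF square_free_solution_axioms assms(2)]
  have Y: "Y = retract_map X r ` X" using epi(1) by (simp add: solution_epi_def)
  obtain a b where ab: "(a, b) \<in> rho X r" "a \<noteq> b"
    using assms(3) exists_retractable_pair unfolding trivial_iff by blast
  then have "a \<in> X" "b \<in> X" by (auto simp: rho_iff)
  then have "\<not> inj_on (retract_map X r) X"
    using ab epi(2) by (auto simp: inj_on_def)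
  then show ?thesis
    using card_image_le[OF finite_X, of "retract_map X r"] eq_card_imp_inj_on[OF finite_X] Y
    by (metis le_neq_implies_less)
qed

lemma iterated_retract_trivial:
  assumes "cyclic_solution X r"
  shows "\<exists>m \<ge> 1. case (Ret ^^ m) (X, r) of (Y, s) \<Rightarrow> trivial_solution Y s"
  using assms
proof (induction "card X" arbitrary: X r rule: less_induct)
  case less
  interpret cyclic_solution X r by fact
  obtain Y s where Ys: "Ret (X, r) = (Y, s)" by fastforce
  note epi = retract_epi(1)[OF square_free_solution_axioms Ys]
  show ?case
  proof (cases "trivial_solution X r")
    case True
    \<comment> \<open>At least one retract has to be taken; that of a trivial solution is again trivial.\<close>
    then show ?thesis using Ys trivial_epi[OF epi] by (intro exI[of _ 1]) simp
  next
    case False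
    have "cyclic_solution Y s" using cyclic_solution_epi[OF epi] .
    then have "\<exists>m \<ge> 1. case (Ret ^^ m) (Y, s) of (Y, s) \<Rightarrow> trivial_solution Y s"
      by (rule less(1)[OF card_retract_less[OF less(2) Ys False]])
    then obtain m where "case (Ret ^^ m) (Y, s) of (Y, s) \<Rightarrow> trivial_solution Y s"
      by (elim exE conjE) (rule that)
    then show ?thesis using Ys by (intro exI[of _ "Suc m"]) (simp add: funpow_swap1)
  qed
qed

lemma exists_proper_invariant:
  fixes X :: "'a elt set"
  assumes "cyclic_solution X r" "card X > 1"
  shows "\<exists>U. square_free_solution.sigma_invariant X r U \<and> U \<noteq> {} \<and> U \<noteq> X"
  using assms
proof (induction "card X" arbitrary: X r rule: less_induct)
  case less
  interpret cyclic_solution X r by fact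
  show ?case
  proof (cases "trivial_solution X r")
    case True
    obtain x where x: "x \<in> X" using less(3) by fastforce
    have "sigma_invariant {x}" using True x by (auto simp: sigma_invariant_def trivial_iff)
    moreover have "{x} \<noteq> X" using less(3) by auto
    ultimately show ?thesis by blast
  next
    case False
    obtain Y s where Ys: "Ret (X, r) = (Y, s)" by fastforce
    note epi = retract_epi[OF square_free_solution_axioms Ys]
    have sol: "cyclic_solution Y s" using cyclic_solution_epi epi(1) .
    then have sol': "square_free_solution Y s" by (simp add: cyclic_solution_def)
    have "card Y > 1"
    proof (rule ccontr)
      assume "\<not> card Y > 1"
      moreover have Y: "Y = retract_map X r ` X" using epi(1) by (simp add: solution_epi_def)
      ultimately have "\<forall>x \<in> X. \<forall>y \<in> X. retract_map X r x = retract_map X r y"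
        using finite_X by (metis One_nat_def card_le_Suc0_iff_eq finite_imageI image_eqI linorder_not_less)
      then have "(x, y) \<in> rho X r" if "x \<in> X" "y \<in> X" for x y
        using epi(2) that by blast
      then have "\<sigma> x y = y" if "x \<in> X" "y \<in> X" for x y
        using that sigma_idem unfolding rho_iff by metis
      then show False using False by (simp add: trivial_iff)
    qed
    then obtain V where "square_free_solution.sigma_invariant Y s V" "V \<noteq> {}" "V \<noteq> Y"
      using less(1) card_retract_less[OF less(2) Ys False] sol by blast
    then show ?thesis using sigma_invariant_vimage[OF epi(1) sol'] by blast
  qed
qed

theorem theorem4p2:
  fixes X :: "'a set" and r :: "'a \<times> 'a \<Rightarrow> 'a \<times> 'a"
  assumes "X \<noteq> {}"
    and "yb_solution X r"
    and "square_free X r"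
    and "\<forall>x \<in> X. cyclic_permutation X (sigma r x)"
  shows "strongly_retractable X r \<and> (card X > 1 \<longrightarrow> generalized_twisted_union X r)"
proof -
  interpret cyclic_solution X r using assms by unfold_locales auto
  obtain X' r' where X': "transport Pt (X, r) = (X', r')" by fastforce
  have inj: "inj_on Pt X" by (simp add: inj_on_def)
  have epi: "solution_epi Pt X r X' r'" using transport_epi[OF inj X'] .
  have sol: "cyclic_solution X' r'" using cyclic_solution_epi[OF epi] .
  have sol': "square_free_solution X' r'" using sol by (simp add: cyclic_solution_def)
  have ret: "strongly_retractable X r"
    unfolding strongly_retractable_def X' using iterated_retract_trivial[OF sol] .
  have "generalized_twisted_union X r" if "card X > 1"
  proof -
    have "card X' > 1" using that epi card_image[OF inj] by (simp add: solution_epi_def)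
    then obtain V where V: "square_free_solution.sigma_invariant X' r' V" "V \<noteq> {}" "V \<noteq> X'"
      using exists_proper_invariant[OF sol] by blast
    then show ?thesis
      using sigma_invariant_vimage[OF epi sol'] generalized_twisted_union_of_invariant by blast
  qed
  with ret show ?thesis by simp
qed

end
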